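(* Let $n$ be a positive integer and let $p$ be an odd prime with $p>2^n$. Then $2^{n-1}p$ has exactly one representation as a sum of consecutive positive integers, namely the following sum of $2^n$ (an even number of) terms: $$2^{n-1}p=\left(\frac{p+1}{2}-2^{n-1}\right)+\left(\frac{p+1}{2}-2^{n-1}+1\right)+\cdots+\left(\frac{p-1}{2}+2^{n-1}\right).$$ Moreover, no positive integers other than those of the form $2^{n-1}p$ with $n$ a positive integer and $p$ an odd prime with $p>2^n$ are expressible exclusively by sums of an even number of consecutive positive integers; that is, any positive integer that has at least one representation as a sum of an even number of consecutive positive integers and no representation as a sum of an odd number of consecutive positive integers is of this form.
   Context: A sum of consecutive positive integers is a sum $a+(a+1)+\cdots+(a+r-1)$ with $r\ge 2$ terms, where $a$ is a positive integer; it is a sum of an odd (respectively even) number of consecutive positive integers if $r$ is odd (respectively even). Two representations are the same if they have the same first term and the same number of terms. *)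

theory Defs
  imports "HOL-Computational_Algebra.Primes"
begin

text \<open>A representation is recorded as the pair of its first term and its number of terms.\<close>

definition consecutive_sum_reps :: "nat \<Rightarrow> (nat \<times> nat) set" where
  "consecutive_sum_reps N = {(a, r). a \<ge> 1 \<and> r \<ge> 2 \<and> N = (\<Sum>i<r. a + i)}"

definition exclusively_even_sums :: "nat \<Rightarrow> bool" where
  "exclusively_even_sums N \<longleftrightarrow>
     (\<exists>(a, r) \<in> consecutive_sum_reps N. even r) \<and>
     \<not> (\<exists>(a, r) \<in> consecutive_sum_reps N. odd r)"

end

theory Submission
  imports Defs
begin

text \<open>
  Doubling a sum of \<open>r\<close> consecutive integers starting at \<open>a\<close> gives \<open>2 * N = r * s\<close> with
  \<open>s = 2 * a + r - 1\<close>, the sum of the first and the last term. The two factors have opposite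
  parity and \<open>r < s\<close> because \<open>a \<ge> 1\<close>; conversely every such factorisation with \<open>r \<ge> 2\<close> comes
  from a representation. So representations of \<open>N\<close> correspond to odd divisors \<open>d > 1\<close> of \<open>N\<close>
  that are the larger factor in \<open>2 * N = d * e\<close> (an even number \<open>e\<close> of terms) or the smaller
  one (an odd number \<open>d\<close> of terms); the divisor \<open>d = 1\<close> would only give the trivial sum.

  For \<open>N = 2 ^ (n - 1) * p\<close> the only odd divisor beyond 1 is \<open>p\<close>, so there is one representation,
  and \<open>p > 2 ^ n\<close> decides that it has \<open>2 ^ n\<close> terms.

  If \<open>N\<close> has no representation of odd length, then every odd divisor \<open>d > 1\<close> of \<open>N\<close> exceeds its
  cofactor \<open>2 * N / d\<close> (\<open>odd_divisor_exceeds_cofactor\<close>). Two odd numbers \<open>c, d > 1\<close> whose product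
  divides \<open>N\<close> would then each exceed the other. Hence the odd part of \<open>N\<close> cannot be split
  and, as a representation of even length forces it to be larger than 1, it is a prime.
\<close>

lemma consecutive_sum_eq:
  "2 * (\<Sum>i<r. a + i) = r * (2 * a + r - 1)" for a r :: nat
proof (induction r)
  case (Suc r)
  then show ?case by (cases r) (auto simp: algebra_simps)
qed simp

lemma consecutive_sum_interval:
  "(\<Sum>i<r. a + i) = (\<Sum>k=a..<a + r. k)" for a r :: nat
  by (induction r) auto

lemma mem_consecutive_sum_reps_iff:
  "(a, r) \<in> consecutive_sum_reps N \<longleftrightarrow> a \<ge> 1 \<and> r \<ge> 2 \<and> 2 * N = r * (2 * a + r - 1)"
  using consecutive_sum_eq[of a r] by (auto simp: consecutive_sum_reps_def)

text \<open>Solving \<open>s = 2 * a + r - 1\<close> for \<open>a\<close> needs \<open>s - r\<close> to be odd, and positive for \<open>a \<ge> 1\<close>.\<close>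

lemma factorisation_imp_rep:
  assumes "2 * N = r * s" "2 \<le> r" "r < s" "odd (r + s)"
  shows "((s + 1 - r) div 2, r) \<in> consecutive_sum_reps N"
proof -
  have "even (s + 1 - r)" using assms by auto
  then obtain a where a: "s + 1 - r = 2 * a" by (elim evenE)
  then have "s = 2 * a + r - 1" "a \<ge> 1" using assms by auto
  then show ?thesis using assms a by (simp add: mem_consecutive_sum_reps_iff)
qed

text \<open>Otherwise \<open>d\<close> would be the smaller factor, hence the length of a representation; equality
  is excluded by parity, since the cofactor \<open>2 * e\<close> is even.\<close>

lemma odd_divisor_exceeds_cofactor:
  assumes no_odd: "\<not> (\<exists>(a, r) \<in> consecutive_sum_reps N. odd r)"
    and N: "N = d * e" and d: "odd d" "d > 1"
  shows "2 * e < d"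
proof (rule ccontr)
  assume "\<not> 2 * e < d"
  moreover have "d \<noteq> 2 * e" using d by auto
  ultimately have "((2 * e + 1 - d) div 2, d) \<in> consecutive_sum_reps N"
    using N d by (intro factorisation_imp_rep) auto
  then show False using no_odd d by blast
qed

lemma odd_dvd_power_of_two_times_prime:
  fixes d p :: nat
  assumes "odd d" "d dvd 2 ^ n * p" "prime p"
  shows "d = 1 \<or> d = p"
proof -
  have "coprime d (2 ^ n)" using assms by (simp add: coprime_commute)
  then have "d dvd p" using assms by (simp add: coprime_dvd_mult_right_iff)
  then show ?thesis using \<open>prime p\<close> by (simp add: prime_nat_iff)
qed

lemma reps_power_of_two_times_prime:
  fixes n p :: nat
  assumes n: "n \<ge> 1" and p: "prime p" "odd p" "p > 2 ^ n"
  shows "consecutive_sum_reps (2 ^ (n - 1) * p) = {((p + 1) div 2 - 2 ^ (n - 1), 2 ^ n)}"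
proof -
  define h :: nat where "h = 2 ^ (n - 1)"
  have two_pow: "2 ^ n = 2 * h" and "h \<ge> 1" using n by (cases n; simp add: h_def)+
  have twoN: "2 * (2 ^ (n - 1) * p) = 2 ^ n * p"
    unfolding two_pow h_def[symmetric] by simp
  have first_term: "(p + 1 - 2 ^ n) div 2 = (p + 1) div 2 - 2 ^ (n - 1)"
    unfolding two_pow h_def[symmetric] by presburger
  have "even ((2::nat) ^ n)" "2 \<le> (2::nat) ^ n"
    unfolding two_pow using \<open>h \<ge> 1\<close> by simp_all
  then have "((p + 1 - 2 ^ n) div 2, 2 ^ n) \<in> consecutive_sum_reps (2 ^ (n - 1) * p)"
    using p by (intro factorisation_imp_rep[OF twoN]) auto
  moreover have "a = (p + 1 - 2 ^ n) div 2 \<and> r = 2 ^ n"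
    if "(a, r) \<in> consecutive_sum_reps (2 ^ (n - 1) * p)" for a r
  proof -
    define s where "s = 2 * a + r - 1"
    have a: "a \<ge> 1" and r: "r \<ge> 2" and rs: "2 ^ n * p = r * s"
      using that unfolding mem_consecutive_sum_reps_iff twoN s_def by blast+
    have s: "s > r" "odd r \<or> odd s" using a r by (auto simp: s_def)
    have "even r"
    proof (rule ccontr)
      assume "odd r"
      moreover have "r dvd 2 ^ n * p" using rs by simp
      ultimately have "r = p"
        using odd_dvd_power_of_two_times_prime[of r n p] r p(1) by auto
      then have "s = 2 ^ n" using rs p(3) by simp
      then show False using \<open>r = p\<close> s(1) p(3) by simp
    qed
    then have "odd s" using s(2) by simp
    moreover have "s dvd 2 ^ n * p" using rs by simp
    ultimately have sp: "s = p"
      using odd_dvd_power_of_two_times_prime[of s n p] r s(1) p(1) by auto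
    then have "r = 2 ^ n" using rs p(3) by simp
    moreover have "a = (s + 1 - r) div 2" using a by (simp add: s_def)
    ultimately show ?thesis using sp by simp
  qed
  ultimately show ?thesis unfolding first_term
    by (intro set_eqI) (metis surj_pair singleton_iff prod.inject)
qed

lemma exclusively_even_sums_imp_form:
  assumes "exclusively_even_sums N" "N \<ge> 1"
  obtains n p :: nat where "n \<ge> 1" "prime p" "odd p" "p > 2 ^ n" "N = 2 ^ (n - 1) * p"
proof -
  have no_odd: "\<not> (\<exists>(a, r) \<in> consecutive_sum_reps N. odd r)"
    using assms by (simp add: exclusively_even_sums_def)
  obtain a r where rep: "(a, r) \<in> consecutive_sum_reps N" and r: "even r"
    using assms by (auto simp: exclusively_even_sums_def)
  define s where "s = 2 * a + r - 1"
  have s: "2 * N = r * s" "odd s" "s > 1"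
    using rep r by (auto simp: mem_consecutive_sum_reps_iff s_def)
  obtain p where p: "prime p" "p dvd s"
    using s prime_factor_nat[of s] by auto
  have odd_p: "odd p" using p s by auto
  have "p dvd 2 * N" using s p by simp
  then have "p dvd N"
    using odd_p by (simp add: coprime_dvd_mult_right_iff)
  then obtain q where q: "N = p * q" by (elim dvdE)
  have p_gt: "2 * q < p"
    using odd_divisor_exceeds_cofactor[OF no_odd q odd_p] prime_gt_1_nat[OF p(1)] by simp
  have "q \<noteq> 0" using q assms by auto
  moreover have "\<not> is_unit (2::nat)" by simp
  ultimately obtain k d where d: "q = 2 ^ k * d" "odd d"
    using multiplicity_decompose'[of q 2] by blast
  \<comment> \<open>The odd divisors \<open>p\<close> and \<open>d > 1\<close> of \<open>N\<close> would each exceed the other.\<close>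
  have "d = 1"
  proof (rule ccontr)
    assume "d \<noteq> 1"
    then have "d > 1" using d(2) by (cases d) auto
    moreover have "N = d * (p * 2 ^ k)" using q d(1) by (simp add: mult.left_commute)
    ultimately have "2 * (p * 2 ^ k) < d"
      using odd_divisor_exceeds_cofactor[OF no_odd] d(2) by blast
    moreover have "p \<le> p * 2 ^ k" by simp
    moreover have "d \<le> q" using d(1) by simp
    ultimately show False using p_gt by linarith
  qed
  then have "q = 2 ^ k" using d(1) by simp
  then show thesis
    using that[of "Suc k" p] p(1) odd_p p_gt q by (simp add: mult.commute)
qed

theorem mainTheorem9:
  "(\<forall>(n::nat) (p::nat). n \<ge> 1 \<and> prime p \<and> odd p \<and> p > 2 ^ n \<longrightarrow>
      consecutive_sum_reps (2 ^ (n - 1) * p) = {((p + 1) div 2 - 2 ^ (n - 1), 2 ^ n)} \<and>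
      2 ^ (n - 1) * p = (\<Sum>k = (p + 1) div 2 - 2 ^ (n - 1)..(p - 1) div 2 + 2 ^ (n - 1). k)) \<and>
   (\<forall>N::nat. N \<ge> 1 \<and> exclusively_even_sums N \<longrightarrow>
      (\<exists>(n::nat) (p::nat). n \<ge> 1 \<and> prime p \<and> odd p \<and> p > 2 ^ n \<and> N = 2 ^ (n - 1) * p))"
proof (intro conjI allI impI)
  fix n p :: nat
  assume A: "n \<ge> 1 \<and> prime p \<and> odd p \<and> p > 2 ^ n"
  let ?a = "(p + 1) div 2 - 2 ^ (n - 1)"
  show reps: "consecutive_sum_reps (2 ^ (n - 1) * p) = {(?a, 2 ^ n)}"
    using A by (intro reps_power_of_two_times_prime) auto
  then have "(?a, 2 ^ n) \<in> consecutive_sum_reps (2 ^ (n - 1) * p)" by simp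
  then have "2 ^ (n - 1) * p = (\<Sum>k=?a..<?a + 2 ^ n. k)"
    unfolding consecutive_sum_reps_def consecutive_sum_interval by simp
  moreover have "{?a..<?a + 2 ^ n} = {?a..(p - 1) div 2 + 2 ^ (n - 1)}"
  proof -
    define h :: nat where "h = 2 ^ (n - 1)"
    have two_pow: "2 ^ n = 2 * h" using A by (cases n) (simp_all add: h_def)
    obtain m where "p = 2 * m + 1" using A by (blast elim: oddE)
    moreover have "2 * h < p" using A two_pow by simp
    ultimately have "?a + 2 ^ n = Suc ((p - 1) div 2 + 2 ^ (n - 1))"
      unfolding two_pow h_def[symmetric] by simp
    then show ?thesis by (simp only: atLeastLessThanSuc_atLeastAtMost)
  qed
  ultimately show "2 ^ (n - 1) * p = (\<Sum>k = ?a..(p - 1) div 2 + 2 ^ (n - 1). k)"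
    by simp
next
  fix N :: nat
  assume "N \<ge> 1 \<and> exclusively_even_sums N"
  then show "\<exists>(n::nat) (p::nat). n \<ge> 1 \<and> prime p \<and> odd p \<and> p > 2 ^ n \<and> N = 2 ^ (n - 1) * p"
    by (meson exclusively_even_sums_imp_form)
qed

end
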